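(* (a) Let $\hat\mu$ be a translation invariant probability measure on $Y$, stationary for the TASM, of density $\hat\rho$. Then: if $\hat\rho\le1$ then $N_{\ge2}=0$ $\hat\mu$-a.s.; if $1\le\hat\rho\le2$ then $N_0=N_{\ge3}=0$ $\hat\mu$-a.s.; and if $\hat\rho\ge2$ then $N_{\le1}=0$ $\hat\mu$-a.s. (b) Let $\mu$ be a translation invariant probability measure on $X$, stationary for the F-TASEP, of density $\rho$. Then: if $0\le\rho\le1/2$ then $\mu(X^{(l)})=1$; if $1/2\le\rho\le2/3$ then $\mu(X^{(i)})=1$; and if $2/3\le\rho\le1$ then $\mu(X^{(h)})=1$.
   Context: $X=\{0,1\}^{\mathbb Z}$ ($1$ = particle, $0$ = hole) and $Y=\mathbb Z_+^{\mathbb Z}$, $\mathbb Z_+=\{0,1,2,\dots\}$. F-TASEP step $U:X\to X$: simultaneously, every particle at a site $j$ with $\eta(j-1)=1$ and $\eta(j+1)=0$ moves to $j+1$. TASM (totally asymmetric stack model) step $\hat U:Y\to Y$: simultaneously, every site $i$ with $\mathbf n(i)\ge2$ sends exactly one particle to site $i+1$. A measure is stationary if it is invariant under push-forward by the one-step map. A measure has density $\rho$ if almost every configuration $\eta$ satisfies $\lim_{N\to\infty}\frac1N\sum_{i=1}^N\eta(i)=\lim_{N\to\infty}\frac1N\sum_{i=-N}^{-1}\eta(i)=\rho$; the density $\hat\rho<\infty$ of a measure on $Y$ is defined in the same way with $\mathbf n(i)$ in place of $\eta(i)$. For $\mathbf n\in Y$, $N_n(\mathbf n)$, $N_{\le n}(\mathbf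 n)$, $N_{\ge n}(\mathbf n)$ denote $\lim_{N\to\infty}\frac1N\#\{1\le i\le N: \mathbf n(i)=n\}$, and similarly with $\mathbf n(i)\le n$, respectively $\mathbf n(i)\ge n$; these limits exist $\hat\mu$-a.s. by the ergodic theorem. $X^{(l)}\subset X$: configurations in which no two adjacent sites are occupied. $X^{(i)}\subset X$: configurations in which no two adjacent sites are empty and no three consecutive sites are occupied. $X^{(h)}\subset X$: configurations in which no two adjacent sites, and no two sites at distance $2$ from each other, are empty. *)

theory Defs
  imports "HOL-Probability.Probability"
begin

type_synonym 'a config = "int \<Rightarrow> 'a"

text \<open>The spaces \<open>X\<close> and \<open>Y\<close> are the types \<^typ>\<open>bool config\<close> (\<^term>\<open>True\<close> is a particle) and
  \<^typ>\<open>nat config\<close>, with the product sigma-algebra of the discrete one.\<close>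

definition config_space :: "'a config measure" where
  "config_space = (\<Pi>\<^sub>M i\<in>UNIV. count_space UNIV)"

definition ftasep_jumps :: "bool config \<Rightarrow> int \<Rightarrow> bool" where
  "ftasep_jumps \<eta> j \<longleftrightarrow> \<eta> (j - 1) \<and> \<eta> j \<and> \<not> \<eta> (j + 1)"

definition ftasep_step :: "bool config \<Rightarrow> bool config" where
  "ftasep_step \<eta> = (\<lambda>j. (\<eta> j \<and> \<not> ftasep_jumps \<eta> j) \<or> ftasep_jumps \<eta> (j - 1))"

definition tasm_step :: "nat config \<Rightarrow> nat config" where
  "tasm_step n = (\<lambda>i. n i - of_bool (n i \<ge> 2) + of_bool (n (i - 1) \<ge> 2))"

definition config_prob :: "'a config measure \<Rightarrow> bool" where
  "config_prob M \<longleftrightarrow> prob_space M \<and> sets M = sets config_space"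

definition translate :: "int \<Rightarrow> 'a config \<Rightarrow> 'a config" where
  "translate k \<eta> = (\<lambda>i. \<eta> (i + k))"

definition translation_invariant :: "'a config measure \<Rightarrow> bool" where
  "translation_invariant M \<longleftrightarrow> (\<forall>k. distr M M (translate k) = M)"

definition stationary :: "('a config \<Rightarrow> 'a config) \<Rightarrow> 'a config measure \<Rightarrow> bool" where
  "stationary T M \<longleftrightarrow> distr M M T = M"

text \<open>The function \<open>v\<close> gives the number of particles that a site value stands for:
  \<^term>\<open>of_bool\<close> on \<open>X\<close> and \<^term>\<open>real\<close> on \<open>Y\<close>.\<close>

definition has_density :: "('a \<Rightarrow> real) \<Rightarrow> 'a config measure \<Rightarrow> real \<Rightarrow> bool" where
  "has_density v M \<rho> \<longleftrightarrow> (AE \<eta> in M.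
     (\<lambda>N. (\<Sum>i = 1..int N. v (\<eta> i)) / real N) \<longlonglongrightarrow> \<rho> \<and>
     (\<lambda>N. (\<Sum>i = - int N..-1. v (\<eta> i)) / real N) \<longlonglongrightarrow> \<rho>)"

text \<open>The limiting frequencies \<open>N\<^sub>n\<close>, \<open>N\<^sub>\<le>\<^sub>n\<close>, \<open>N\<^sub>\<ge>\<^sub>n\<close>, as relations: each says that the limit exists
  and equals \<open>r\<close>.\<close>

definition has_freq :: "(nat \<Rightarrow> bool) \<Rightarrow> nat config \<Rightarrow> real \<Rightarrow> bool" where
  "has_freq P n r \<longleftrightarrow> (\<lambda>N. real (card {i \<in> {1..int N}. P (n i)}) / real N) \<longlonglongrightarrow> r"

definition N_eq :: "nat \<Rightarrow> nat config \<Rightarrow> real \<Rightarrow> bool" where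
  "N_eq k n r \<longleftrightarrow> has_freq (\<lambda>m. m = k) n r"

definition N_le :: "nat \<Rightarrow> nat config \<Rightarrow> real \<Rightarrow> bool" where
  "N_le k n r \<longleftrightarrow> has_freq (\<lambda>m. m \<le> k) n r"

definition N_ge :: "nat \<Rightarrow> nat config \<Rightarrow> real \<Rightarrow> bool" where
  "N_ge k n r \<longleftrightarrow> has_freq (\<lambda>m. m \<ge> k) n r"

definition X_l :: "bool config set" where
  "X_l = {\<eta>. \<forall>j. \<not> (\<eta> j \<and> \<eta> (j + 1))}"

definition X_i :: "bool config set" where
  "X_i = {\<eta>. (\<forall>j. \<not> (\<not> \<eta> j \<and> \<not> \<eta> (j + 1))) \<and> (\<forall>j. \<not> (\<eta> j \<and> \<eta> (j + 1) \<and> \<eta> (j + 2)))}"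

definition X_h :: "bool config set" where
  "X_h = {\<eta>. (\<forall>j. \<not> (\<not> \<eta> j \<and> \<not> \<eta> (j + 1))) \<and> (\<forall>j. \<not> (\<not> \<eta> j \<and> \<not> \<eta> (j + 2)))}"

text \<open>Measurability of the maps and sets above; otherwise \<^const>\<open>distr\<close> and \<^const>\<open>measure\<close> would
  not have their intended meaning.\<close>

lemma space_config_space [simp]: "space config_space = UNIV"
  by (simp add: config_space_def space_PiM)

lemma measurable_site [measurable]:
  "(\<lambda>\<eta>. \<eta> i) \<in> measurable config_space (count_space UNIV)"
  unfolding config_space_def by (rule measurable_component_singleton) simp

lemma measurable_into_config_space:
  assumes "\<And>i. (\<lambda>\<eta>. f \<eta> i) \<in> measurable M (count_space UNIV)"
  shows "f \<in> measurable M config_space"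
  unfolding config_space_def by (rule measurable_PiM_single') (use assms in auto)

lemma measurable_translate: "translate k \<in> measurable config_space config_space"
  by (rule measurable_into_config_space) (simp add: translate_def)

lemma measurable_ftasep_step: "ftasep_step \<in> measurable config_space config_space"
  by (rule measurable_into_config_space)
     (unfold ftasep_step_def ftasep_jumps_def, measurable)

lemma measurable_tasm_step: "tasm_step \<in> measurable config_space config_space"
  by (rule measurable_into_config_space) (unfold tasm_step_def of_bool_def, measurable)

lemma sets_X_l: "X_l \<in> sets config_space"
proof -
  have "{\<eta> \<in> space config_space. \<forall>j. \<not> (\<eta> j \<and> \<eta> (j + 1))} \<in> sets config_space"
    by measurable
  then show ?thesis by (simp add: X_l_def)
qed

lemma sets_X_i: "X_i \<in> sets config_space"
proof -
  have "{\<eta> \<in> space config_space. (\<forall>j. \<not> (\<not> \<eta> j \<and> \<not> \<eta> (j + 1))) \<and>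
      (\<forall>j. \<not> (\<eta> j \<and> \<eta> (j + 1) \<and> \<eta> (j + 2)))} \<in> sets config_space"
    by measurable
  then show ?thesis by (simp add: X_i_def)
qed

lemma sets_X_h: "X_h \<in> sets config_space"
proof -
  have "{\<eta> \<in> space config_space. (\<forall>j. \<not> (\<not> \<eta> j \<and> \<not> \<eta> (j + 1))) \<and>
      (\<forall>j. \<not> (\<not> \<eta> j \<and> \<not> \<eta> (j + 2)))} \<in> sets config_space"
    by measurable
  then show ?thesis by (simp add: X_h_def)
qed

end

theory Submission
  imports Defs
begin

text \<open>If an event can be left but not entered under the dynamics, stationarity forces that it is
  a.s. never left. In the stack model this applies to \<open>n(i) = 0\<close> and to \<open>n(i) \<ge> k\<close>, \<open>k \<ge> 3\<close>, so a.s.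
  the left neighbour of an empty stack has height at most 1 and that of a stack of height at least 3
  has height at least 2. A violation of the same rule further to the left would come closer in one
  step, so induction on the distance makes every site to the left obey it, and recurrence
  under translations extends this to all sites. Hence a.s. either some stack is empty and all have
  height at most 1, or some stack has height at least 3 and all have height at least 2, or all
  heights are 1 or 2. In each phase suitable combinations such as \<open>1 - n(i)\<close> have a sign, and the
  density decides which phases have positive probability. The exclusion process is treated
  likewise: holes separate the stacks, adjacent holes \<open>00\<close> are an empty stack, and \<open>111\<close> occurs in
  a stack of height at least 3. Truncation and dominated convergence replace the ergodic theorem.\<close>

section \<open>Translation invariant measures\<close>

text \<open>The preimage of \<open>S\<close> lies in \<open>S\<close> and has the same probability,
  so the difference is null.\<close>

lemma (in prob_space) AE_preserved_if_backward_closed: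
  assumes T: "T \<in> measurable M M" and inv: "distr M M T = M" and S: "S \<in> sets M"
    and backward: "\<And>x. x \<in> space M \<Longrightarrow> T x \<in> S \<Longrightarrow> x \<in> S"
  shows "AE x in M. x \<in> S \<longrightarrow> T x \<in> S"
proof -
  let ?V = "T -` S \<inter> space M"
  have V: "?V \<in> sets M" using T S by (rule measurable_sets)
  have "prob ?V = prob S" using measure_distr[OF T S] inv by simp
  moreover have "?V \<subseteq> S" using backward by auto
  ultimately have "prob (S - ?V) = 0" using S V by (simp add: finite_measure_Diff)
  then have "AE x in M. x \<notin> S - ?V" using S V by (simp add: prob_eq_0)
  with AE_space show ?thesis by eventually_elim auto
qed

lemma Ex_int_shift: "(\<exists>i. P (i + k)) \<longleftrightarrow> (\<exists>i::int. P i)"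
  by (metis diff_add_cancel)

locale translation_invariant_config = prob_space M for M :: "'a config measure" +
  assumes sets_M [measurable_cong]: "sets M = sets config_space"
    and invariant: "translation_invariant M"
begin

lemma space_M [simp]: "space M = UNIV"
  using sets_eq_imp_space_eq[OF sets_M] by simp

lemma sets_Collect_pred: "Measurable.pred M P \<Longrightarrow> {\<eta>. P \<eta>} \<in> sets M"
  by (simp add: pred_def)

lemma measurable_M_iff: "f \<in> measurable M M \<longleftrightarrow> f \<in> measurable config_space config_space"
  using measurable_cong_sets[OF sets_M sets_M] by simp

lemma measurable_translate_M [measurable]: "translate k \<in> measurable M M"
  by (simp add: measurable_M_iff measurable_translate)

lemma distr_translate: "distr M M (translate k) = M"
  using invariant by (simp add: translation_invariant_def)

lemma AE_translate:
  assumes "AE \<eta> in M. P \<eta>"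
  shows "AE \<eta> in M. \<forall>k. P (translate k \<eta>)"
proof -
  have "AE \<eta> in M. P (translate k \<eta>)" for k
    by (rule AE_distrD[OF measurable_translate_M]) (simp only: distr_translate assms)
  then show ?thesis by (simp add: AE_all_countable)
qed

lemma prob_translate:
  assumes "S \<in> sets M"
  shows "prob (translate k -` S) = prob S"
  using measure_distr[OF measurable_translate_M assms] distr_translate by simp

lemma AE_step:
  assumes T: "T \<in> measurable config_space config_space" and "stationary T M"
    and P: "AE \<eta> in M. P \<eta>"
  shows "AE \<eta> in M. P (T \<eta>)"
proof (rule AE_distrD[of T M M])
  show "T \<in> measurable M M" using T by (simp add: measurable_M_iff)
  show "AE \<eta> in distr M M T. P \<eta>" using assms by (simp only: stationary_def)
qed

text \<open>One-sided Poincare recurrence: the event of a hit at or beyond \<open>m\<close> shrinks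
  as \<open>m\<close> grows, while translation turns \<open>m\<close> into \<open>m + 1\<close> and
  keeps the probability.\<close>

lemma AE_recurrent_right:
  assumes S [measurable]: "S \<in> sets M"
  shows "AE \<eta> in M. (\<exists>i. translate i \<eta> \<in> S) \<longrightarrow> (\<forall>m. \<exists>i\<ge>m. translate i \<eta> \<in> S)"
proof -
  define C where "C m = {\<eta>. \<exists>i\<ge>m. translate i \<eta> \<in> S}" for m
  have C_sets: "C m \<in> sets M" for m
    unfolding C_def by (rule sets_Collect_pred) measurable
  have shift: "translate 1 \<eta> \<in> C m \<longleftrightarrow> \<eta> \<in> C (m + 1)" for \<eta> m
  proof -
    have eq: "translate i (translate 1 \<eta>) = translate (i + 1) \<eta>" for i
      by (simp add: translate_def add.assoc)
    show ?thesis
    proof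
      assume "translate 1 \<eta> \<in> C m"
      then obtain i where "i \<ge> m" "translate (i + 1) \<eta> \<in> S" by (auto simp: C_def eq)
      then show "\<eta> \<in> C (m + 1)" by (auto simp: C_def intro!: exI[of _ "i + 1"])
    next
      assume "\<eta> \<in> C (m + 1)"
      then obtain i where "i \<ge> m + 1" "translate i \<eta> \<in> S" by (auto simp: C_def)
      then show "translate 1 \<eta> \<in> C m" by (auto simp: C_def eq intro!: exI[of _ "i - 1"])
    qed
  qed
  have mono: "C m' \<subseteq> C m" if "m \<le> m'" for m m'
    using that by (auto simp: C_def intro: order_trans)
  have "AE \<eta> in M. \<eta> \<in> C m \<longrightarrow> \<eta> \<in> C (m + 1)" for m
    using AE_preserved_if_backward_closed[OF measurable_translate_M distr_translate C_sets, of 1 m]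
      mono[of m "m + 1"] by (auto simp: shift)
  then have "AE \<eta> in M. \<forall>m. \<eta> \<in> C m \<longrightarrow> \<eta> \<in> C (m + 1)" by (simp add: AE_all_countable)
  then show ?thesis
  proof eventually_elim
    case (elim \<eta>)
    show ?case
    proof (intro impI allI)
      fix m
      assume "\<exists>i. translate i \<eta> \<in> S"
      then obtain i where i: "\<eta> \<in> C i" by (auto simp: C_def)
      \<comment> \<open>\<open>max\<close> covers both orders: climb from \<open>i\<close> if
        \<open>m\<close> is larger, then descend by \<open>mono\<close>.\<close>
      have "\<eta> \<in> C (max i m)"
        by (rule int_ge_induct[of i "max i m"]) (use i elim in auto)
      then have "\<eta> \<in> C m" using mono[of m "max i m"] by auto
      then show "\<exists>i\<ge>m. translate i \<eta> \<in> S" by (simp add: C_def)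
    qed
  qed
qed

text \<open>On \<open>A\<close> the averages of \<open>g\<close> are nonnegative, so their limit
  must be 0. Truncation to values between 0 and 1 supplies integrability; the truncated averages
  share one expectation, which dominated convergence shows to be 0.\<close>

lemma AE_zero_if_mean_nonpos:
  fixes g :: "'a config \<Rightarrow> real"
  assumes A [measurable]: "A \<in> sets M" and A_inv: "\<And>k \<eta>. translate k \<eta> \<in> A \<longleftrightarrow> \<eta> \<in> A"
    and g [measurable]: "g \<in> borel_measurable M"
    and nonneg: "AE \<eta> in M. \<eta> \<in> A \<longrightarrow> 0 \<le> g \<eta>"
    and mean: "AE \<eta> in M. (\<lambda>N. (\<Sum>i = 1..int N. g (translate i \<eta>)) / real N) \<longlonglongrightarrow> c"
    and c: "c \<le> 0"
  shows "AE \<eta> in M. \<eta> \<in> A \<longrightarrow> (\<forall>k. g (translate k \<eta>) = 0)"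
proof -
  define h where "h \<eta> = indicator A \<eta> * min 1 (max 0 (g \<eta>))" for \<eta>
  define avg where "avg N \<eta> = (\<Sum>i = 1..int N. h (translate i \<eta>)) / real N" for N \<eta>
  have h_meas [measurable]: "h \<in> borel_measurable M" unfolding h_def by measurable
  have avg_meas [measurable]: "avg N \<in> borel_measurable M" for N unfolding avg_def by measurable
  have h_bounds: "0 \<le> h \<eta>" "h \<eta> \<le> 1" for \<eta> by (auto simp: h_def indicator_def)
  have h_int: "integrable M h"
    by (rule integrable_const_bound[of _ 1]) (use h_bounds in auto)
  have h_translate_int: "integrable M (\<lambda>\<eta>. h (translate i \<eta>))" for i
    by (rule integrable_const_bound[of _ 1]) (use h_bounds in auto)
  have avg_bound: "norm (avg N \<eta>) \<le> 1" for N \<eta>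
  proof -
    have "(\<Sum>i = 1..int N. h (translate i \<eta>)) \<le> real N"
      using sum_bounded_above[of "{1..int N}" "\<lambda>i. h (translate i \<eta>)" 1] h_bounds by simp
    moreover have "0 \<le> (\<Sum>i = 1..int N. h (translate i \<eta>))" by (simp add: sum_nonneg h_bounds)
    ultimately show ?thesis by (auto simp: avg_def divide_le_eq)
  qed
  have avg_lim: "AE \<eta> in M. (\<lambda>N. avg N \<eta>) \<longlonglongrightarrow> 0"
    using AE_translate[OF nonneg] mean
  proof eventually_elim
    case (elim \<eta>)
    show ?case
    proof (cases "\<eta> \<in> A")
      case False
      then show ?thesis by (simp add: avg_def h_def A_inv)
    next
      case True
      let ?a = "\<lambda>N. (\<Sum>i = 1..int N. g (translate i \<eta>)) / real N"
      have pos: "0 \<le> g (translate i \<eta>)" for i using elim(1) True A_inv by blast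
      then have a_pos: "0 \<le> ?a N" for N by (simp add: sum_nonneg)
      have "0 \<le> c" by (rule LIMSEQ_le_const[OF elim(2)]) (use a_pos in blast)
      then have lim: "?a \<longlonglongrightarrow> 0" using elim(2) c by simp
      have "avg N \<eta> \<le> ?a N" for N
        unfolding avg_def
        by (intro divide_right_mono sum_mono) (use pos in \<open>auto simp: h_def indicator_def\<close>)
      moreover have "0 \<le> avg N \<eta>" for N by (simp add: avg_def sum_nonneg h_bounds)
      ultimately show ?thesis
        by (intro tendsto_sandwich[OF _ _ tendsto_const lim]) auto
    qed
  qed
  have "(\<lambda>N. \<integral>\<eta>. avg N \<eta> \<partial>M) \<longlonglongrightarrow> (\<integral>\<eta>. 0 \<partial>M)"
    by (rule integral_dominated_convergence[where w = "\<lambda>_. 1"])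
      (use avg_lim avg_bound in auto)
  \<comment> \<open>\<open>N = 0\<close> is left out because division by zero makes that average
    0.\<close>
  moreover have "(\<integral>\<eta>. avg N \<eta> \<partial>M) = (\<integral>\<eta>. h \<eta> \<partial>M)" if "N > 0" for N
  proof -
    have "(\<integral>\<eta>. h (translate i \<eta>) \<partial>M) = (\<integral>\<eta>. h \<eta> \<partial>M)" for i
      using integral_distr[OF measurable_translate_M h_meas, of i] distr_translate by simp
    then show ?thesis
      using that by (simp add: avg_def h_translate_int)
  qed
  then have "(\<lambda>N. \<integral>\<eta>. avg N \<eta> \<partial>M) \<longlonglongrightarrow> (\<integral>\<eta>. h \<eta> \<partial>M)"
    by (intro tendsto_eventually eventually_sequentiallyI[of 1]) auto
  ultimately have "(\<integral>\<eta>. h \<eta> \<partial>M) = 0" using LIMSEQ_unique by fastforce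
  then have "AE \<eta> in M. h \<eta> = 0"
    using integral_nonneg_eq_0_iff_AE[OF h_int] h_bounds by simp
  \<comment> \<open>A truncated value 0 would also allow negative \<open>g\<close>; nonnegativity at
    every translate rules this out.\<close>
  from AE_translate[OF this] AE_translate[OF nonneg] show ?thesis
    by eventually_elim (auto simp: h_def A_inv indicator_def min_def max_def split: if_splits)
qed

text \<open>Each of the \<open>K\<close> window terms averages a shifted copy of the configuration,
  with the same density. \<open>Q\<close> will be a phase, \<open>a\<close> a sign, and
  \<open>K\<close> is 1 for stacks, 2 for hole pairs, 3 for triples.\<close>

lemma AE_window_zero_if_density:
  fixes v :: "'a \<Rightarrow> real"
  assumes density: "has_density v M \<rho>" and nonpos: "a * (real K * \<rho>) + b \<le> 0"
    and Q: "Measurable.pred M Q" "\<And>k \<eta>. Q (translate k \<eta>) \<longleftrightarrow> Q \<eta>"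
    and nonneg: "AE \<eta> in M. Q \<eta> \<longrightarrow> 0 \<le> a * (\<Sum>k<K. v (\<eta> (int k))) + b"
  shows "AE \<eta> in M. Q \<eta> \<longrightarrow> (\<forall>i. a * (\<Sum>k<K. v (\<eta> (i + int k))) + b = 0)"
proof -
  define g where "g \<eta> = a * (\<Sum>k<K. v (\<eta> (int k))) + b" for \<eta>
  have v_meas [measurable]: "(\<lambda>\<eta>. v (\<eta> i)) \<in> borel_measurable M" for i
    by (rule measurable_compose[of "\<lambda>\<eta>. \<eta> i" M "count_space UNIV" v]) auto
  have g_meas: "g \<in> borel_measurable M" unfolding g_def by measurable
  have "AE \<eta> in M. (\<lambda>N. (\<Sum>i = 1..int N. v (\<eta> i)) / real N) \<longlonglongrightarrow> \<rho>"
    using density unfolding has_density_def by eventually_elim simp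
  from AE_translate[OF this]
  have mean: "AE \<eta> in M. (\<lambda>N. (\<Sum>i = 1..int N. g (translate i \<eta>)) / real N)
      \<longlonglongrightarrow> a * (real K * \<rho>) + b"
  proof eventually_elim
    case (elim \<eta>)
    have "(\<lambda>N. a * (\<Sum>k<K. (\<Sum>i = 1..int N. v (translate (int k) \<eta> i)) / real N) + b)
        \<longlonglongrightarrow> a * (\<Sum>k<K. \<rho>) + b"
      by (intro tendsto_intros elim[rule_format])
    moreover have "(\<Sum>i = 1..int N. g (translate i \<eta>)) / real N
        = a * (\<Sum>k<K. (\<Sum>i = 1..int N. v (translate (int k) \<eta> i)) / real N) + b" if "N > 0" for N
    proof -
      have "(\<Sum>i = 1..int N. g (translate i \<eta>))
          = a * (\<Sum>i = 1..int N. \<Sum>k<K. v (translate (int k) \<eta> i)) + real N * b"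
        by (simp add: g_def translate_def sum.distrib sum_distrib_left add.commute)
      also have "(\<Sum>i = 1..int N. \<Sum>k<K. v (translate (int k) \<eta> i))
          = (\<Sum>k<K. \<Sum>i = 1..int N. v (translate (int k) \<eta> i))"
        by (rule sum.swap)
      finally show ?thesis using that by (simp add: add_divide_distrib flip: sum_divide_distrib)
    qed
    ultimately show ?case
      by (auto elim!: Lim_transform_eventually intro!: eventually_sequentiallyI[of 1])
  qed
  have "AE \<eta> in M. \<eta> \<in> {\<eta>. Q \<eta>} \<longrightarrow> (\<forall>i. g (translate i \<eta>) = 0)"
    by (rule AE_zero_if_mean_nonpos[OF _ _ g_meas _ mean nonpos])
      (use Q nonneg in \<open>auto simp: g_def intro: sets_Collect_pred\<close>)
  then show ?thesis by (simp add: g_def translate_def add.commute)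
qed

end

section \<open>The stack model\<close>

locale stationary_tasm = translation_invariant_config M for M :: "nat config measure" +
  assumes stationary: "stationary tasm_step M"
begin

lemma AE_tasm_step: "AE n in M. P n \<Longrightarrow> AE n in M. P (tasm_step n)"
  by (rule AE_step[OF measurable_tasm_step stationary])

section \<open>Stack model: rules to the left of extreme stacks\<close>

lemma AE_tasm_preserved:
  assumes "Measurable.pred M (\<lambda>n. P n)" "\<And>n. P (tasm_step n) \<Longrightarrow> P n"
  shows "AE n in M. P n \<longrightarrow> P (tasm_step n)"
  using AE_preserved_if_backward_closed[of tasm_step "{n. P n}"] assms stationary
  by (simp add: measurable_M_iff measurable_tasm_step stationary_def pred_def)

text \<open>No step empties a stack, since a sender keeps at least one particle. So an empty stack
  a.s. stays empty and its left neighbour does not send.\<close>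

lemma AE_zero_left: "AE n in M. \<forall>i. n i = 0 \<longrightarrow> n (i - 1 - int m) \<le> 1"
proof -
  have "AE n in M. n i = 0 \<longrightarrow> tasm_step n i = 0" for i
    by (rule AE_tasm_preserved) (auto simp: tasm_step_def of_bool_def split: if_splits)
  then have "AE n in M. \<forall>i. n i = 0 \<longrightarrow> tasm_step n i = 0" by (simp add: AE_all_countable)
  then have base: "AE n in M. \<forall>i. n i = 0 \<longrightarrow> n (i - 1) \<le> 1"
    by eventually_elim (auto simp: tasm_step_def of_bool_def not_le less_Suc_eq_le numeral_2_eq_2 split: if_splits)
  show ?thesis
  proof (induction m)
    case 0
    then show ?case using base by simp
  next
    case (Suc m)
    from base Suc AE_tasm_step[OF Suc] show ?case
    proof eventually_elim
      case (elim n)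
      show ?case
      proof (intro allI impI, rule ccontr)
        fix i
        assume i: "n i = 0" and "\<not> n (i - 1 - int (Suc m)) \<le> 1"
        then have two: "n (i - 1 - int m - 1) \<ge> 2" by (simp add: algebra_simps)
        with elim(1) have "n (i - 1 - int m) \<noteq> 0" by fastforce
        \<comment> \<open>Height exactly 1 next to a sender grows to 2: a violation at the smaller
          distance after the step.\<close>
        with elim(2) i have "n (i - 1 - int m) = 1" by (metis le_antisym One_nat_def Suc_leI neq0_conv)
        with two have "tasm_step n (i - 1 - int m) = 2" by (simp add: tasm_step_def)
        moreover have "tasm_step n i = 0"
          using elim(1)[rule_format, OF i] i by (simp add: tasm_step_def)
        ultimately show False using elim(3)[rule_format, of i] by simp
      qed
    qed
  qed
qed

text \<open>A sender gains at most what it loses, and a stack of height at most 1 reaches at most 2.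
  So no threshold from 3 on is newly reached, and a.s. none is lost.\<close>

lemma AE_three_left: "AE n in M. \<forall>i. n i \<ge> 3 \<longrightarrow> n (i - 1 - int m) \<ge> 2"
proof -
  have "AE n in M. n i \<ge> k + 3 \<longrightarrow> tasm_step n i \<ge> k + 3" for i k
    by (rule AE_tasm_preserved) (auto simp: tasm_step_def of_bool_def split: if_splits)
  then have "AE n in M. \<forall>i k. n i \<ge> k + 3 \<longrightarrow> tasm_step n i \<ge> k + 3"
    by (simp add: AE_all_countable)
  then have base: "AE n in M. \<forall>i. n i \<ge> 3 \<longrightarrow> n (i - 1) \<ge> 2"
  proof eventually_elim
    case (elim n)
    show ?case
    proof (intro allI impI)
      fix i
      assume "n i \<ge> 3"
      \<comment> \<open>With the threshold at the current height, preservation means that the stack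
        does not shrink, so its left neighbour sends.\<close>
      with elim[rule_format, of "n i - 3" i] show "n (i - 1) \<ge> 2"
        by (auto simp: tasm_step_def of_bool_def split: if_splits)
    qed
  qed
  show ?thesis
  proof (induction m)
    case 0
    then show ?case using base by simp
  next
    case (Suc m)
    from base Suc AE_tasm_step[OF Suc] show ?case
    proof eventually_elim
      case (elim n)
      show ?case
      proof (intro allI impI, rule ccontr)
        fix i
        assume i: "n i \<ge> 3" and "\<not> n (i - 1 - int (Suc m)) \<ge> 2"
        then have one: "n (i - 1 - int m - 1) \<le> 1" by (simp add: algebra_simps)
        with elim(1) have "\<not> n (i - 1 - int m) \<ge> 3" by fastforce
        \<comment> \<open>Height exactly 2 without supply drops to 1, again a closer
          violation.\<close>
        with elim(2) i have "n (i - 1 - int m) = 2"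
          by (metis Suc_1 Suc_leI eval_nat_numeral(3) le_neq_implies_less)
        with one have "tasm_step n (i - 1 - int m) = 1" by (simp add: tasm_step_def)
        moreover have "tasm_step n i \<ge> 3"
          using elim(1)[rule_format, OF i] i by (simp add: tasm_step_def)
        ultimately show False using elim(3)[rule_format, of i] by simp
      qed
    qed
  qed
qed

section \<open>Stack model: the phases\<close>

text \<open>Recurrence puts an empty stack to the right of any \<open>j\<close>, and the leftward
  rule reaches \<open>j\<close> from there.\<close>

lemma AE_zero_imp_le_one: "AE n in M. (\<exists>i. n i = 0) \<longrightarrow> (\<forall>j. n j \<le> 1)"
proof -
  have S: "{n. n 0 = 0} \<in> sets M" by (rule sets_Collect_pred) measurable
  have "AE n in M. \<forall>m i. n i = 0 \<longrightarrow> n (i - 1 - int m) \<le> 1"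
    using AE_zero_left by (simp add: AE_all_countable)
  with AE_recurrent_right[OF S] show ?thesis
  proof eventually_elim
    case (elim n)
    show ?case
    proof (intro impI allI)
      fix j
      assume "\<exists>i. n i = 0"
      with elim(1) obtain i where "i \<ge> j + 1" "n i = 0" by (auto simp: translate_def)
      with elim(2)[rule_format, of i "nat (i - 1 - j)"] show "n j \<le> 1" by simp
    qed
  qed
qed

lemma AE_three_imp_ge_two: "AE n in M. (\<exists>i. n i \<ge> 3) \<longrightarrow> (\<forall>j. n j \<ge> 2)"
proof -
  have S: "{n. n 0 \<ge> 3} \<in> sets M" by (rule sets_Collect_pred) measurable
  have "AE n in M. \<forall>m i. n i \<ge> 3 \<longrightarrow> n (i - 1 - int m) \<ge> 2"
    using AE_three_left by (simp add: AE_all_countable)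
  with AE_recurrent_right[OF S] show ?thesis
  proof eventually_elim
    case (elim n)
    show ?case
    proof (intro impI allI)
      fix j
      assume "\<exists>i. n i \<ge> 3"
      with elim(1) obtain i where "i \<ge> j + 1" "n i \<ge> 3" by (auto simp: translate_def)
      with elim(2)[rule_format, of i "nat (i - 1 - j)"] show "n j \<ge> 2" by simp
    qed
  qed
qed

section \<open>Stack model: the density selects the phase\<close>

text \<open>Without empty stacks \<open>n i - 1\<close> is nonnegative with mean at most 0, so all
  heights are 1.\<close>

lemma AE_less_two:
  assumes "has_density real M \<rho>" "\<rho> \<le> 1"
  shows "AE n in M. \<forall>i. n i < 2"
proof -
  have "AE n in M. \<not> (\<exists>i. n i = 0) \<longrightarrow> (\<forall>i. 1 * (\<Sum>k<1. real (n (i + int k))) + - 1 = 0)"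
  proof (rule AE_window_zero_if_density[OF assms(1)])
    show "Measurable.pred M (\<lambda>n. \<not> (\<exists>i. n i = 0))" by measurable
    show "\<not> (\<exists>i. translate k n i = 0) \<longleftrightarrow> \<not> (\<exists>i. n i = 0)" for k :: int and n :: "nat config"
      using Ex_int_shift[of "\<lambda>i. n i = 0" k] by (simp add: translate_def)
    show "AE n in M. \<not> (\<exists>i. n i = 0) \<longrightarrow> 0 \<le> 1 * (\<Sum>k<1. real (n (int k))) + - 1"
      by (auto simp: Suc_le_eq)
  qed (use assms in simp)
  with AE_zero_imp_le_one show ?thesis by eventually_elim (force simp: less_Suc_eq_le numeral_2_eq_2)
qed

text \<open>With an empty stack \<open>1 - n i\<close> is nonnegative with mean at most 0; all
  heights would be 1, a contradiction.\<close>

lemma AE_nonzero: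
  assumes "has_density real M \<rho>" "\<rho> \<ge> 1"
  shows "AE n in M. \<forall>i. n i \<noteq> 0"
proof -
  have "AE n in M. (\<exists>i. n i = 0) \<longrightarrow> (\<forall>i. - 1 * (\<Sum>k<1. real (n (i + int k))) + 1 = 0)"
  proof (rule AE_window_zero_if_density[OF assms(1)])
    show "Measurable.pred M (\<lambda>n. \<exists>i. n i = 0)" by measurable
    show "(\<exists>i. translate k n i = 0) \<longleftrightarrow> (\<exists>i. n i = 0)" for k :: int and n :: "nat config"
      using Ex_int_shift[of "\<lambda>i. n i = 0" k] by (simp add: translate_def)
    show "AE n in M. (\<exists>i. n i = 0) \<longrightarrow> 0 \<le> - 1 * (\<Sum>k<1. real (n (int k))) + 1"
      using AE_zero_imp_le_one by eventually_elim auto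
  qed (use assms in simp)
  then show ?thesis by eventually_elim auto
qed

lemma AE_less_three:
  assumes "has_density real M \<rho>" "\<rho> \<le> 2"
  shows "AE n in M. \<forall>i. n i < 3"
proof -
  have "AE n in M. (\<exists>i. n i \<ge> 3) \<longrightarrow> (\<forall>i. 1 * (\<Sum>k<1. real (n (i + int k))) + - 2 = 0)"
  proof (rule AE_window_zero_if_density[OF assms(1)])
    show "Measurable.pred M (\<lambda>n. \<exists>i. n i \<ge> 3)" by measurable
    show "(\<exists>i. translate k n i \<ge> 3) \<longleftrightarrow> (\<exists>i. n i \<ge> 3)" for k :: int and n :: "nat config"
      using Ex_int_shift[of "\<lambda>i. n i \<ge> 3" k] by (simp add: translate_def)
    show "AE n in M. (\<exists>i. n i \<ge> 3) \<longrightarrow> 0 \<le> 1 * (\<Sum>k<1. real (n (int k))) + - 2"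
      using AE_three_imp_ge_two by eventually_elim auto
  qed (use assms in simp)
  then show ?thesis by eventually_elim (force simp: not_less)
qed

lemma AE_ge_two:
  assumes "has_density real M \<rho>" "\<rho> \<ge> 2"
  shows "AE n in M. \<forall>i. n i \<ge> 2"
proof -
  have "AE n in M. \<not> (\<exists>i. n i \<ge> 3) \<longrightarrow> (\<forall>i. - 1 * (\<Sum>k<1. real (n (i + int k))) + 2 = 0)"
  proof (rule AE_window_zero_if_density[OF assms(1)])
    show "Measurable.pred M (\<lambda>n. \<not> (\<exists>i. n i \<ge> 3))" by measurable
    show "\<not> (\<exists>i. translate k n i \<ge> 3) \<longleftrightarrow> \<not> (\<exists>i. n i \<ge> 3)" for k :: int and n :: "nat config"
      using Ex_int_shift[of "\<lambda>i. n i \<ge> 3" k] by (simp add: translate_def)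
    show "AE n in M. \<not> (\<exists>i. n i \<ge> 3) \<longrightarrow> 0 \<le> - 1 * (\<Sum>k<1. real (n (int k))) + 2"
      by (auto simp: not_le less_Suc_eq_le eval_nat_numeral)
  qed (use assms in simp)
  with AE_three_imp_ge_two show ?thesis by eventually_elim auto
qed

end

section \<open>The facilitated exclusion process\<close>

locale stationary_ftasep = translation_invariant_config M for M :: "bool config measure" +
  assumes stationary: "stationary ftasep_step M"
begin

lemma AE_ftasep_step: "AE \<eta> in M. P \<eta> \<Longrightarrow> AE \<eta> in M. P (ftasep_step \<eta>)"
  by (rule AE_step[OF measurable_ftasep_step stationary])

lemma measurable_ftasep_step_M [measurable]: "ftasep_step \<in> measurable M M"
  by (simp add: measurable_M_iff measurable_ftasep_step)

text \<open>A jump into \<open>j\<close> needs a hole there, so the occupied and the empty case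
  separate.\<close>

lemma ftasep_step_iff:
  "ftasep_step \<eta> j \<longleftrightarrow> (if \<eta> j then \<not> \<eta> (j - 1) \<or> \<eta> (j + 1) else \<eta> (j - 1) \<and> \<eta> (j - 2))"
  by (auto simp: ftasep_step_def ftasep_jumps_def)

text \<open>A pair of adjacent holes can only persist in place, never be created, so it is a.s. never
  destroyed by an arriving particle.\<close>

lemma AE_hole_pair_left_neighbours:
  "AE \<eta> in M. \<forall>i. \<not> \<eta> i \<and> \<not> \<eta> (i + 1) \<longrightarrow> \<not> (\<eta> (i - 1) \<and> \<eta> (i - 2))"
proof -
  have "AE \<eta> in M. \<eta> \<in> {\<eta>. \<not> \<eta> i \<and> \<not> \<eta> (i + 1)}
      \<longrightarrow> ftasep_step \<eta> \<in> {\<eta>. \<not> \<eta> i \<and> \<not> \<eta> (i + 1)}" for i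
    by (rule AE_preserved_if_backward_closed[OF measurable_ftasep_step_M])
      (use stationary in \<open>auto simp: stationary_def ftasep_step_iff
        intro!: sets_Collect_pred\<close>)
  then have "AE \<eta> in M. \<forall>i. \<not> \<eta> i \<and> \<not> \<eta> (i + 1)
      \<longrightarrow> \<not> ftasep_step \<eta> i \<and> \<not> ftasep_step \<eta> (i + 1)"
    by (simp add: AE_all_countable)
  then show ?thesis
    by eventually_elim (auto simp: ftasep_step_iff)
qed

text \<open>The nearest \<open>11\<close> to the left of \<open>00\<close> must be followed by \<open>01\<close>, and \<open>1101\<close> becomes \<open>1011\<close>: the
  \<open>11\<close> has moved two sites closer.\<close>

lemma AE_hole_pair_left:
  "AE \<eta> in M. \<forall>i. \<not> \<eta> i \<and> \<not> \<eta> (i + 1) \<longrightarrow> \<not> (\<eta> (i - 1 - int m) \<and> \<eta> (i - 2 - int m))"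
proof (induction m rule: less_induct)
  case (less m)
  then have IH: "AE \<eta> in M. \<forall>m' < m. \<forall>i. \<not> \<eta> i \<and> \<not> \<eta> (i + 1)
      \<longrightarrow> \<not> (\<eta> (i - 1 - int m') \<and> \<eta> (i - 2 - int m'))"
    by (subst AE_all_countable) (auto intro: AE_impI)
  from AE_hole_pair_left_neighbours IH AE_ftasep_step[OF IH] show ?case
  proof eventually_elim
    case (elim \<eta>)
    show ?case
    proof (intro allI impI notI)
      fix i
      define a where "a = i - 1 - int m"
      assume i: "\<not> \<eta> i \<and> \<not> \<eta> (i + 1)" and "\<eta> (i - 1 - int m) \<and> \<eta> (i - 2 - int m)"
      moreover have "i - 2 - int m = a - 1" by (simp add: a_def)
      ultimately have a: "\<eta> a" "\<eta> (a - 1)" by (simp_all add: a_def)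
      have "m \<noteq> 0"
      proof
        assume "m = 0"
        then have "i = a + 1" by (simp add: a_def)
        then show False using elim(1)[rule_format, of i] i a by simp
      qed
      \<comment> \<open>Distance \<open>m - 1\<close> admits no violation, so \<open>11\<close>
        cannot sit at \<open>a, a + 1\<close>.\<close>
      then have "i - 1 - int (m - 1) = a + 1" "i - 2 - int (m - 1) = a" by (auto simp: a_def)
      with \<open>m \<noteq> 0\<close> have a1: "\<not> \<eta> (a + 1)"
        using elim(2)[rule_format, of "m - 1" i] i a by simp
      \<comment> \<open>Otherwise \<open>00\<close> at \<open>a + 1\<close> would directly follow
        \<open>11\<close>.\<close>
      then have a2: "\<eta> (a + 2)"
        using elim(1)[rule_format, of "a + 1"] a by (auto simp: add.commute)
      then have "a + 2 \<noteq> i" using i by auto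
      with \<open>m \<noteq> 0\<close> have "m \<ge> 2" by (auto simp: a_def)
      have "ftasep_step \<eta> (a + 1)" "ftasep_step \<eta> (a + 2)"
        using a a1 a2 by (simp_all add: ftasep_step_iff add.commute)
      \<comment> \<open>The pair survives: the neighbour rule blocks entry into \<open>i\<close>,
        and the hole at \<open>i\<close> blocks entry into \<open>i + 1\<close>.\<close>
      moreover have "\<not> ftasep_step \<eta> i" "\<not> ftasep_step \<eta> (i + 1)"
        using i elim(1)[rule_format, of i]
        by (auto simp: ftasep_step_iff)
      moreover have "i - 1 - int (m - 2) = a + 2" "i - 2 - int (m - 2) = a + 1"
        using \<open>m \<ge> 2\<close> by (auto simp: a_def)
      moreover have "\<not> (ftasep_step \<eta> (i - 1 - int (m - 2)) \<and> ftasep_step \<eta> (i - 2 - int (m - 2)))"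
        using elim(3)[rule_format, of "m - 2" i] \<open>m \<ge> 2\<close> calculation by auto
      ultimately show False by metis
    qed
  qed
qed

text \<open>After a step the block \<open>111\<close> occupies \<open>j, j+1, j+2\<close> exactly if before it there was \<open>1111\<close>
  from \<open>j\<close> or \<open>110111\<close> from \<open>j - 2\<close>. Comparing with the splitting of \<open>111\<close> by its left neighbour
  shows that \<open>0111\<close> is a.s. preceded by \<open>11\<close>.\<close>

lemma AE_triple_left_neighbours:
  "AE \<eta> in M. \<forall>i. \<eta> i \<and> \<eta> (i + 1) \<and> \<eta> (i + 2) \<longrightarrow> \<eta> (i - 1) \<or> (\<eta> (i - 2) \<and> \<eta> (i - 3))"
proof -
  define S where "S = {\<eta>::bool config. \<eta> 0 \<and> \<eta> 1 \<and> \<eta> 2}"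
  define F where "F j = {\<eta>::bool config. \<eta> j \<and> \<eta> (j + 1) \<and> \<eta> (j + 2) \<and> \<eta> (j + 3)}" for j
  define G where "G j = {\<eta>::bool config. \<eta> j \<and> \<eta> (j + 1) \<and> \<not> \<eta> (j + 2)
    \<and> \<eta> (j + 3) \<and> \<eta> (j + 4) \<and> \<eta> (j + 5)}" for j
  have [measurable]: "S \<in> sets M" unfolding S_def by (rule sets_Collect_pred) measurable
  have [measurable]: "F j \<in> sets M" for j unfolding F_def by (rule sets_Collect_pred) measurable
  have [measurable]: "G j \<in> sets M" for j unfolding G_def by (rule sets_Collect_pred) measurable
  have "ftasep_step -` S = F 0 \<union> G (- 2)"
    by (auto simp: S_def F_def G_def ftasep_step_iff)
  moreover have "prob (ftasep_step -` S) = prob S"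
    using measure_distr[OF measurable_ftasep_step_M, of S] stationary
    by (simp add: stationary_def)
  moreover have "F 0 \<inter> G (- 2) = {}" "F (- 1) \<inter> G (- 3) = {}" by (auto simp: F_def G_def)
  \<comment> \<open>Shifting both pieces one site to the left keeps their probability and places
    them inside \<open>S\<close>.\<close>
  moreover have "translate (- 1) -` F 0 = F (- 1)" by (auto simp: F_def translate_def)
  then have "prob (F (- 1)) = prob (F 0)" using prob_translate[of "F 0" "- 1"] by simp
  moreover have "translate (- 1) -` G (- 2) = G (- 3)" by (auto simp: G_def translate_def)
  then have "prob (G (- 3)) = prob (G (- 2))" using prob_translate[of "G (- 2)" "- 1"] by simp
  ultimately have "prob (F (- 1) \<union> G (- 3)) = prob S"
    by (simp add: finite_measure_Union)
  moreover have "F (- 1) \<union> G (- 3) \<subseteq> S" by (auto simp: S_def F_def G_def)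
  ultimately have "prob (S - (F (- 1) \<union> G (- 3))) = 0"
    by (simp add: finite_measure_Diff)
  then have "AE \<eta> in M. \<eta> \<notin> S - (F (- 1) \<union> G (- 3))" by (simp add: prob_eq_0)
  from AE_translate[OF this] show ?thesis
    by eventually_elim (auto simp: S_def F_def G_def translate_def algebra_simps)
qed

text \<open>The nearest hole to the left of \<open>111\<close> that is not preceded by \<open>11\<close> must be followed by \<open>110\<close>,
  and \<open>0110\<close> becomes \<open>0101\<close>: the second hole of the result is again not preceded by \<open>11\<close>. Meanwhile
  the block \<open>111\<close> stays or moves one site to the left, so the distance decreases by two or three.\<close>

lemma AE_triple_left:
  "AE \<eta> in M. \<forall>i. \<eta> i \<and> \<eta> (i + 1) \<and> \<eta> (i + 2)
    \<longrightarrow> \<eta> (i - 1 - int m) \<or> (\<eta> (i - 2 - int m) \<and> \<eta> (i - 3 - int m))"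
proof (induction m rule: less_induct)
  case (less m)
  then have IH: "AE \<eta> in M. \<forall>m' < m. \<forall>i. \<eta> i \<and> \<eta> (i + 1) \<and> \<eta> (i + 2)
    \<longrightarrow> \<eta> (i - 1 - int m') \<or> (\<eta> (i - 2 - int m') \<and> \<eta> (i - 3 - int m'))"
    by (subst AE_all_countable) (auto intro: AE_impI)
  from AE_triple_left_neighbours IH AE_ftasep_step[OF IH] show ?case
  proof eventually_elim
    case (elim \<eta>)
    show ?case
    proof (intro allI impI, rule ccontr)
      fix i
      define h where "h = i - 1 - int m"
      assume i: "\<eta> i \<and> \<eta> (i + 1) \<and> \<eta> (i + 2)"
        and "\<not> (\<eta> (i - 1 - int m) \<or> (\<eta> (i - 2 - int m) \<and> \<eta> (i - 3 - int m)))"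
      moreover have "i - 2 - int m = h - 1" "i - 3 - int m = h - 2" by (simp_all add: h_def)
      ultimately have h: "\<not> \<eta> h" "\<not> (\<eta> (h - 1) \<and> \<eta> (h - 2))" by (simp_all add: h_def)
      have "m \<noteq> 0"
      proof
        assume "m = 0"
        then have "i = h + 1" by (simp add: h_def)
        then show False using elim(1)[rule_format, of i] i h by (simp add: add.commute)
      qed
      then have "i - 1 - int (m - 1) = h + 1" "i - 2 - int (m - 1) = h" by (auto simp: h_def)
      with \<open>m \<noteq> 0\<close> have h1: "\<eta> (h + 1)"
        using elim(2)[rule_format, of "m - 1" i] i h by auto
      have h2: "\<eta> (h + 2)"
      proof (cases "m = 1")
        case True
        then show ?thesis using i by (simp add: h_def)
      next
        case False
        with \<open>m \<noteq> 0\<close> have "m \<ge> 2" by simp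
        then have "\<eta> (i - 1 - int (m - 2)) \<or> \<eta> (i - 3 - int (m - 2))"
          using elim(2)[rule_format, of "m - 2" i] i by auto
        moreover have "i - 1 - int (m - 2) = h + 2" "i - 3 - int (m - 2) = h"
          using \<open>m \<ge> 2\<close> by (auto simp: h_def)
        ultimately show ?thesis using h by metis
      qed
      \<comment> \<open>Otherwise \<open>111\<close> at \<open>h + 1\<close> would break the
        neighbour rule at the hole \<open>h\<close>.\<close>
      have h3: "\<not> \<eta> (h + 3)"
        using elim(1)[rule_format, of "h + 1"] h h1 h2 by (auto simp: add.commute)
      then have "h + 3 \<noteq> i" "h + 3 \<noteq> i + 1" using i by metis+
      with \<open>m \<noteq> 0\<close> have "m \<ge> 3" by (auto simp: h_def)
      have step_h: "\<not> ftasep_step \<eta> (h + 2)" "\<not> ftasep_step \<eta> h"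
        using h h1 h2 h3 by (simp_all add: ftasep_step_iff add.commute)
      show False
      proof (cases "\<eta> (i + 3)")
        case True
        then have "ftasep_step \<eta> i \<and> ftasep_step \<eta> (i + 1) \<and> ftasep_step \<eta> (i + 2)"
          using i by (simp add: ftasep_step_iff add.commute)
        moreover have "i - 1 - int (m - 2) = h + 2" "i - 3 - int (m - 2) = h"
          using \<open>m \<ge> 3\<close> by (auto simp: h_def)
        moreover have "ftasep_step \<eta> (i - 1 - int (m - 2)) \<or> ftasep_step \<eta> (i - 3 - int (m - 2))"
          using elim(3)[rule_format, of "m - 2" i] \<open>m \<ge> 3\<close> calculation by auto
        ultimately show False using step_h by metis
      next
        case False
        \<comment> \<open>The last particle of the block jumps off. Site \<open>i - 1\<close> stays
          occupied or, by the neighbour rule, is filled from the \<open>11\<close> behind it, so the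
          block now starts there.\<close>
        have "ftasep_step \<eta> (i - 1) \<and> ftasep_step \<eta> (i - 1 + 1) \<and> ftasep_step \<eta> (i - 1 + 2)"
          using i elim(1)[rule_format, of i]
          by (auto simp: ftasep_step_iff add.commute)
        moreover have "i - 1 - 1 - int (m - 3) = h + 2" "i - 1 - 3 - int (m - 3) = h"
          using \<open>m \<ge> 3\<close> by (auto simp: h_def)
        moreover have "ftasep_step \<eta> (i - 1 - 1 - int (m - 3)) \<or> ftasep_step \<eta> (i - 1 - 3 - int (m - 3))"
          using elim(3)[rule_format, of "m - 3" "i - 1"] \<open>m \<ge> 3\<close> calculation by auto
        ultimately show False using step_h by metis
      qed
    qed
  qed
qed

section \<open>Exclusion process: the phases\<close>

lemma AE_hole_pair_imp_X_l: "AE \<eta> in M. (\<exists>i. \<not> \<eta> i \<and> \<not> \<eta> (i + 1)) \<longrightarrow> \<eta> \<in> X_l"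
proof -
  have S: "{\<eta>. \<not> \<eta> 0 \<and> \<not> \<eta> 1} \<in> sets M" by (rule sets_Collect_pred) measurable
  have "AE \<eta> in M. \<forall>m i. \<not> \<eta> i \<and> \<not> \<eta> (i + 1) \<longrightarrow> \<not> (\<eta> (i - 1 - int m) \<and> \<eta> (i - 2 - int m))"
    by (subst AE_all_countable) (use AE_hole_pair_left in auto)
  with AE_recurrent_right[OF S] show ?thesis
  proof eventually_elim
    case (elim \<eta>)
    show ?case
      unfolding X_l_def
    proof (intro impI CollectI allI)
      fix j
      assume "\<exists>i. \<not> \<eta> i \<and> \<not> \<eta> (i + 1)"
      with elim(1) obtain i where i: "i \<ge> j + 2" "\<not> \<eta> i" "\<not> \<eta> (i + 1)"
        by (auto simp: translate_def add.commute)
      let ?m = "nat (i - 2 - j)"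
      have "i - 1 - int ?m = j + 1" "i - 2 - int ?m = j" using i by auto
      moreover have "\<not> (\<eta> (i - 1 - int ?m) \<and> \<eta> (i - 2 - int ?m))" using elim(2) i by blast
      ultimately show "\<not> (\<eta> j \<and> \<eta> (j + 1))" by metis
    qed
  qed
qed

text \<open>Both conditions are reindexed to look to the left, the form in which the rule about
  \<open>111\<close> propagates.\<close>

lemma X_h_iff: "\<eta> \<in> X_h \<longleftrightarrow> (\<forall>j. \<eta> j \<or> (\<eta> (j - 1) \<and> \<eta> (j - 2)))"
proof -
  have "(\<forall>j. \<eta> j \<or> \<eta> (j + 1)) \<longleftrightarrow> (\<forall>j. \<eta> (j - 1) \<or> \<eta> j)"
    by (metis add_diff_cancel diff_add_cancel)
  moreover have "(\<forall>j. \<eta> j \<or> \<eta> (j + 2)) \<longleftrightarrow> (\<forall>j. \<eta> (j - 2) \<or> \<eta> j)"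
    by (metis add_diff_cancel diff_add_cancel)
  ultimately show ?thesis unfolding X_h_def by auto
qed

lemma AE_triple_imp_X_h: "AE \<eta> in M. (\<exists>i. \<eta> i \<and> \<eta> (i + 1) \<and> \<eta> (i + 2)) \<longrightarrow> \<eta> \<in> X_h"
proof -
  have S: "{\<eta>. \<eta> 0 \<and> \<eta> 1 \<and> \<eta> 2} \<in> sets M" by (rule sets_Collect_pred) measurable
  have "AE \<eta> in M. \<forall>m i. \<eta> i \<and> \<eta> (i + 1) \<and> \<eta> (i + 2)
      \<longrightarrow> \<eta> (i - 1 - int m) \<or> (\<eta> (i - 2 - int m) \<and> \<eta> (i - 3 - int m))"
    by (subst AE_all_countable) (use AE_triple_left in auto)
  with AE_recurrent_right[OF S] show ?thesis
  proof eventually_elim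
    case (elim \<eta>)
    show ?case
      unfolding X_h_iff
    proof (intro impI allI)
      fix j
      assume "\<exists>i. \<eta> i \<and> \<eta> (i + 1) \<and> \<eta> (i + 2)"
      with elim(1) obtain i where i: "i \<ge> j + 1" "\<eta> i" "\<eta> (i + 1)" "\<eta> (i + 2)"
        by (auto simp: translate_def add.commute)
      let ?m = "nat (i - 1 - j)"
      have "i - 1 - int ?m = j" "i - 2 - int ?m = j - 1" "i - 3 - int ?m = j - 2" using i by auto
      moreover have "\<eta> (i - 1 - int ?m) \<or> (\<eta> (i - 2 - int ?m) \<and> \<eta> (i - 3 - int ?m))"
        using elim(2) i by blast
      ultimately show "\<eta> j \<or> (\<eta> (j - 1) \<and> \<eta> (j - 2))" by metis
    qed
  qed
qed

lemma pred_hole_pair: "Measurable.pred M (\<lambda>\<eta>. \<exists>i. \<not> \<eta> i \<and> \<not> \<eta> (i + 1))"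
  and pred_triple: "Measurable.pred M (\<lambda>\<eta>. \<exists>i. \<eta> i \<and> \<eta> (i + 1) \<and> \<eta> (i + 2))"
  by measurable

lemma translate_hole_pair:
  "(\<exists>i. \<not> translate k \<eta> i \<and> \<not> translate k \<eta> (i + 1)) \<longleftrightarrow> (\<exists>i. \<not> \<eta> i \<and> \<not> \<eta> (i + 1))"
  using Ex_int_shift[of "\<lambda>i. \<not> \<eta> i \<and> \<not> \<eta> (i + 1)" k] by (simp add: translate_def ac_simps)

lemma translate_triple:
  "(\<exists>i. translate k \<eta> i \<and> translate k \<eta> (i + 1) \<and> translate k \<eta> (i + 2))
    \<longleftrightarrow> (\<exists>i. \<eta> i \<and> \<eta> (i + 1) \<and> \<eta> (i + 2))"
  using Ex_int_shift[of "\<lambda>i. \<eta> i \<and> \<eta> (i + 1) \<and> \<eta> (i + 2)" k]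
  by (simp add: translate_def ac_simps)

lemma sum_lessThan_2: "(\<Sum>k<2. f k) = f 0 + f (Suc 0)" for f :: "nat \<Rightarrow> real"
  by (simp add: eval_nat_numeral)

lemma sum_lessThan_3: "(\<Sum>k<3. f k) = f 0 + f (Suc 0) + f 2" for f :: "nat \<Rightarrow> real"
  by (simp add: eval_nat_numeral)

section \<open>Exclusion process: the density selects the phase\<close>

text \<open>Without \<open>00\<close> each window of two holds at least one particle; the mean
  \<open>2 * \<rho> - 1\<close> is at most 0, so it holds exactly one.\<close>

lemma AE_X_l:
  assumes "has_density of_bool M \<rho>" "\<rho> \<le> 1 / 2"
  shows "AE \<eta> in M. \<eta> \<in> X_l"
proof -
  have "AE \<eta> in M. \<not> (\<exists>i. \<not> \<eta> i \<and> \<not> \<eta> (i + 1))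
      \<longrightarrow> (\<forall>i. 1 * (\<Sum>k<2. of_bool (\<eta> (i + int k))) + - 1 = (0 :: real))"
  proof (rule AE_window_zero_if_density[OF assms(1)])
    show "Measurable.pred M (\<lambda>\<eta>. \<not> (\<exists>i. \<not> \<eta> i \<and> \<not> \<eta> (i + 1)))"
      using pred_hole_pair by measurable
    show "AE \<eta> in M. \<not> (\<exists>i. \<not> \<eta> i \<and> \<not> \<eta> (i + 1))
        \<longrightarrow> (0 :: real) \<le> 1 * (\<Sum>k<2. of_bool (\<eta> (int k))) + - 1"
    proof (intro AE_I2 impI)
      fix \<eta> :: "bool config"
      assume "\<not> (\<exists>i. \<not> \<eta> i \<and> \<not> \<eta> (i + 1))"
      then have "\<eta> 0 \<or> \<eta> (0 + 1)" by blast
      then show "(0 :: real) \<le> 1 * (\<Sum>k<2. of_bool (\<eta> (int k))) + - 1"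
        by (auto simp: sum_lessThan_2)
    qed
    show "(\<not> (\<exists>i. \<not> translate k \<eta> i \<and> \<not> translate k \<eta> (i + 1))) \<longleftrightarrow> (\<not> (\<exists>i. \<not> \<eta> i \<and> \<not> \<eta> (i + 1)))"
      for k :: int and \<eta> :: "bool config"
      by (simp only: translate_hole_pair)
  qed (use assms in simp)
  with AE_hole_pair_imp_X_l show ?thesis
  proof eventually_elim
    case (elim \<eta>)
    show ?case
    proof (cases "\<exists>i. \<not> \<eta> i \<and> \<not> \<eta> (i + 1)")
      case False
      have "\<not> (\<eta> j \<and> \<eta> (j + 1))" for j
        using elim(2)[rule_format, OF False, of j] by (auto simp: sum_lessThan_2)
      then show ?thesis by (simp add: X_l_def)
    qed (use elim in simp)
  qed
qed

text \<open>If \<open>00\<close> occurs, \<open>11\<close> does not, and the density would force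
  exactly one particle into every window of two.\<close>

lemma AE_no_hole_pair:
  assumes "has_density of_bool M \<rho>" "\<rho> \<ge> 1 / 2"
  shows "AE \<eta> in M. \<not> (\<exists>i. \<not> \<eta> i \<and> \<not> \<eta> (i + 1))"
proof -
  have "AE \<eta> in M. (\<exists>i. \<not> \<eta> i \<and> \<not> \<eta> (i + 1))
      \<longrightarrow> (\<forall>i. - 1 * (\<Sum>k<2. of_bool (\<eta> (i + int k))) + 1 = (0 :: real))"
  proof (rule AE_window_zero_if_density[OF assms(1) _ pred_hole_pair translate_hole_pair])
    show "AE \<eta> in M. (\<exists>i. \<not> \<eta> i \<and> \<not> \<eta> (i + 1))
        \<longrightarrow> (0 :: real) \<le> - 1 * (\<Sum>k<2. of_bool (\<eta> (int k))) + 1"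
      using AE_hole_pair_imp_X_l
      by eventually_elim (auto simp: X_l_def sum_lessThan_2 of_bool_def dest: spec[of _ 0])
  qed (use assms in simp)
  then show ?thesis
  proof eventually_elim
    case (elim \<eta>)
    show ?case
    proof
      assume ex: "\<exists>i. \<not> \<eta> i \<and> \<not> \<eta> (i + 1)"
      then obtain i where "\<not> \<eta> i" "\<not> \<eta> (i + 1)" by blast
      with elim[rule_format, OF ex, of i] show False by (simp add: sum_lessThan_2)
    qed
  qed
qed

text \<open>If \<open>111\<close> occurs, each window of three holds at least two particles; the
  density would force exactly two everywhere.\<close>

lemma AE_no_triple:
  assumes "has_density of_bool M \<rho>" "\<rho> \<le> 2 / 3"
  shows "AE \<eta> in M. \<not> (\<exists>i. \<eta> i \<and> \<eta> (i + 1) \<and> \<eta> (i + 2))"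
proof -
  have "AE \<eta> in M. (\<exists>i. \<eta> i \<and> \<eta> (i + 1) \<and> \<eta> (i + 2))
      \<longrightarrow> (\<forall>i. 1 * (\<Sum>k<3. of_bool (\<eta> (i + int k))) + - 2 = (0 :: real))"
  proof (rule AE_window_zero_if_density[OF assms(1) _ pred_triple translate_triple])
    show "AE \<eta> in M. (\<exists>i. \<eta> i \<and> \<eta> (i + 1) \<and> \<eta> (i + 2))
        \<longrightarrow> (0 :: real) \<le> 1 * (\<Sum>k<3. of_bool (\<eta> (int k))) + - 2"
      using AE_triple_imp_X_h
    proof eventually_elim
      case (elim \<eta>)
      show ?case
      proof
        assume "\<exists>i. \<eta> i \<and> \<eta> (i + 1) \<and> \<eta> (i + 2)"
        with elim have "\<forall>j. \<eta> j \<or> (\<eta> (j - 1) \<and> \<eta> (j - 2))" by (simp add: X_h_iff)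
        \<comment> \<open>These two instances exclude two holes among the sites 0, 1, 2.\<close>
        from this[rule_format, of 1] this[rule_format, of 2]
        show "(0 :: real) \<le> 1 * (\<Sum>k<3. of_bool (\<eta> (int k))) + - 2"
          by (auto simp: sum_lessThan_3)
      qed
    qed
  qed (use assms in simp)
  then show ?thesis
  proof eventually_elim
    case (elim \<eta>)
    show ?case
    proof
      assume ex: "\<exists>i. \<eta> i \<and> \<eta> (i + 1) \<and> \<eta> (i + 2)"
      then obtain i where "\<eta> i" "\<eta> (i + 1)" "\<eta> (i + 2)" by blast
      with elim[rule_format, OF ex, of i] show False by (simp add: sum_lessThan_3)
    qed
  qed
qed

text \<open>Without \<open>111\<close> each window of three has a hole, and by the density exactly
  one, so holes are at least 3 apart.\<close>

lemma AE_X_h: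
  assumes "has_density of_bool M \<rho>" "\<rho> \<ge> 2 / 3"
  shows "AE \<eta> in M. \<eta> \<in> X_h"
proof -
  have "AE \<eta> in M. \<not> (\<exists>i. \<eta> i \<and> \<eta> (i + 1) \<and> \<eta> (i + 2))
      \<longrightarrow> (\<forall>i. - 1 * (\<Sum>k<3. of_bool (\<eta> (i + int k))) + 2 = (0 :: real))"
  proof (rule AE_window_zero_if_density[OF assms(1)])
    show "Measurable.pred M (\<lambda>\<eta>. \<not> (\<exists>i. \<eta> i \<and> \<eta> (i + 1) \<and> \<eta> (i + 2)))"
      using pred_triple by measurable
    show "AE \<eta> in M. \<not> (\<exists>i. \<eta> i \<and> \<eta> (i + 1) \<and> \<eta> (i + 2))
        \<longrightarrow> (0 :: real) \<le> - 1 * (\<Sum>k<3. of_bool (\<eta> (int k))) + 2"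
    proof (intro AE_I2 impI)
      fix \<eta> :: "bool config"
      assume "\<not> (\<exists>i. \<eta> i \<and> \<eta> (i + 1) \<and> \<eta> (i + 2))"
      then have "\<not> (\<eta> 0 \<and> \<eta> (0 + 1) \<and> \<eta> (0 + 2))" by blast
      then show "(0 :: real) \<le> - 1 * (\<Sum>k<3. of_bool (\<eta> (int k))) + 2"
        by (auto simp: sum_lessThan_3)
    qed
    show "(\<not> (\<exists>i. translate k \<eta> i \<and> translate k \<eta> (i + 1) \<and> translate k \<eta> (i + 2)))
        \<longleftrightarrow> (\<not> (\<exists>i. \<eta> i \<and> \<eta> (i + 1) \<and> \<eta> (i + 2)))"
      for k :: int and \<eta> :: "bool config"
      by (simp only: translate_triple)
  qed (use assms in simp)
  with AE_triple_imp_X_h show ?thesis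
  proof eventually_elim
    case (elim \<eta>)
    show ?case
    proof (cases "\<exists>i. \<eta> i \<and> \<eta> (i + 1) \<and> \<eta> (i + 2)")
      case False
      have "\<eta> j \<or> (\<eta> (j - 1) \<and> \<eta> (j - 2))" for j
        using elim(2)[rule_format, OF False, of "j - 2"]
        by (auto simp: sum_lessThan_3 of_bool_def split: if_splits)
      then show ?thesis by (simp add: X_h_iff)
    qed (use elim in simp)
  qed
qed

lemma AE_X_i:
  assumes "has_density of_bool M \<rho>" "1 / 2 \<le> \<rho>" "\<rho> \<le> 2 / 3"
  shows "AE \<eta> in M. \<eta> \<in> X_i"
  using AE_no_hole_pair[OF assms(1,2)] AE_no_triple[OF assms(1,3)]
  by eventually_elim (auto simp: X_i_def)

lemma measure_X_eq_1:
  assumes "has_density of_bool M \<rho>"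
  shows "\<rho> \<le> 1 / 2 \<Longrightarrow> prob X_l = 1"
    and "1 / 2 \<le> \<rho> \<Longrightarrow> \<rho> \<le> 2 / 3 \<Longrightarrow> prob X_i = 1"
    and "2 / 3 \<le> \<rho> \<Longrightarrow> prob X_h = 1"
  using AE_X_l[OF assms] AE_X_i[OF assms] AE_X_h[OF assms]
  by (simp_all add: prob_eq_1 sets_M sets_X_l sets_X_i sets_X_h)

end

text \<open>The stack results exclude heights at every site, so the counts are 0 for every
  \<open>N\<close>.\<close>

lemma has_freq_zero: "(\<And>i. \<not> P (n i)) \<Longrightarrow> has_freq P n 0"
  by (simp add: has_freq_def)

theorem corollary2p3:
  shows "(\<forall>(M :: nat config measure) (\<rho> :: real).
            config_prob M \<and> translation_invariant M \<and> stationary tasm_step M \<and>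
            has_density real M \<rho> \<longrightarrow>
              (\<rho> \<le> 1 \<longrightarrow> (AE n in M. N_ge 2 n 0)) \<and>
              (1 \<le> \<rho> \<and> \<rho> \<le> 2 \<longrightarrow> (AE n in M. N_eq 0 n 0 \<and> N_ge 3 n 0)) \<and>
              (\<rho> \<ge> 2 \<longrightarrow> (AE n in M. N_le 1 n 0)))
       \<and> (\<forall>(M :: bool config measure) (\<rho> :: real).
            config_prob M \<and> translation_invariant M \<and> stationary ftasep_step M \<and>
            has_density of_bool M \<rho> \<longrightarrow>
              (0 \<le> \<rho> \<and> \<rho> \<le> 1 / 2 \<longrightarrow> measure M X_l = 1) \<and>
              (1 / 2 \<le> \<rho> \<and> \<rho> \<le> 2 / 3 \<longrightarrow> measure M X_i = 1) \<and>
              (2 / 3 \<le> \<rho> \<and> \<rho> \<le> 1 \<longrightarrow> measure M X_h = 1))"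
proof (intro conjI allI impI; elim conjE)
  fix M :: "nat config measure" and \<rho> :: real
  assume M: "config_prob M" "translation_invariant M" "stationary tasm_step M"
    and density: "has_density real M \<rho>"
  interpret prob_space M using M by (simp add: config_prob_def)
  interpret stationary_tasm M
    by unfold_locales (use M in \<open>simp_all add: config_prob_def\<close>)
  show "AE n in M. N_ge 2 n 0" if "\<rho> \<le> 1"
    using AE_less_two[OF density that]
    by eventually_elim (simp add: N_ge_def not_le has_freq_zero)
  show "AE n in M. N_eq 0 n 0 \<and> N_ge 3 n 0" if "1 \<le> \<rho>" "\<rho> \<le> 2"
    using AE_nonzero[OF density that(1)] AE_less_three[OF density that(2)]
    by eventually_elim (simp add: N_eq_def N_ge_def not_le has_freq_zero)
  show "AE n in M. N_le 1 n 0" if "\<rho> \<ge> 2"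
    using AE_ge_two[OF density that]
    by eventually_elim (simp add: N_le_def not_le has_freq_zero Suc_le_eq numeral_2_eq_2)
next
  fix M :: "bool config measure" and \<rho> :: real
  assume M: "config_prob M" "translation_invariant M" "stationary ftasep_step M"
    and density: "has_density of_bool M \<rho>"
  interpret prob_space M using M by (simp add: config_prob_def)
  interpret stationary_ftasep M
    by unfold_locales (use M in \<open>simp_all add: config_prob_def\<close>)
  show "measure M X_l = 1" if "\<rho> \<le> 1 / 2" by (rule measure_X_eq_1(1)[OF density that])
  show "measure M X_i = 1" if "1 / 2 \<le> \<rho>" "\<rho> \<le> 2 / 3"
    by (rule measure_X_eq_1(2)[OF density that])
  show "measure M X_h = 1" if "2 / 3 \<le> \<rho>" by (rule measure_X_eq_1(3)[OF density that])
qed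

end
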